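(* For $T\geq1$ let $p=p(T)$. Let $(U_{ti}\colon i\geq1)$, $t\geq1$, be i.i.d. copies (in $t$) of a stationary process with $EU_{11}=0$, $EU_{11}^2=\sigma^2$, $EU_{11}^4<\infty$, with absolutely summable autocovariance function $\gamma_U$ and spectral density $$g(\theta):=\sum_{h\in\mathbb{Z}}\gamma_U(h)e^{\mathrm{i}h\theta},$$ and put $U_t=(U_{t1},\ldots,U_{tp})^\prime$. Let $\hat\sigma^2$ be a consistent estimator of $\sigma^2$, with $\hat\sigma^4=(\hat\sigma^2)^2$. Let $\mathcal{F}=\mathcal{F}(T)\subset\{1,\ldots,\lfloor p/2\rfloor\}$ be a set of indices of fundamental frequencies with $f=|\mathcal{F}|\geq2$. Assume that $\mathrm{Var}(I_{U_1}(\theta_\ell))$ is uniformly bounded over all $\ell\in\mathcal{F}$ and all dimensions $p$, and that, with $\bar g=\frac1f\sum_{\ell\in\mathcal{F}}g(\theta_\ell)$, there is some $\delta>0$ such that $$\frac{1}{f-1}\sum_{\ell\in\mathcal{F}}(g(\theta_\ell)-\bar g)^2>\delta,$$ where, when $f$ diverges, this inequality holds uniformly in $f$. Let $S_\xi^2$ be the empirical variance of the components of $\xi=T^{-1}\sum_{t=1}^TI_{U_t}(\boldsymbol\theta)$, and set $$\Lambda_{\mathrm{fin}}:=(f-1)TS_\xi^2/\hat\sigma^4,\qquad\Lambda_{\mathrm{inf}}:=\left(TS_\xi^2/\hat\sigma^4-1\right)\sqrt{(f-1)/2}.$$ (i) If $0\leq\psi_T=o(T)$, then $\Lambda_{\mathrm{fin}}/\psi_T\to\infty$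 (in probability) as $T\to\infty$. (ii) If additionally $f=f(T)\to\infty$, $f/T\to0$, and if $0\leq\psi_T=o(T\sqrt f)$, then $\Lambda_{\mathrm{inf}}/\psi_T\to\infty$ (in probability) as $T\to\infty$.
   Context: For a vector $Z=(Z_1,\ldots,Z_n)^\prime$ with mean $\bar Z=\frac1n\sum_{k=1}^nZ_k$, the empirical variance of its components is $S_Z^2=\frac{1}{n-1}\sum_{k=1}^n(Z_k-\bar Z)^2$. For $Z=(Z_1,\ldots,Z_p)^\prime$ the periodogram is $$I_Z(\theta)=\frac1p\left|\sum_{k=1}^pZ_ke^{-\mathrm{i}k\theta}\right|^2,\qquad\mathrm{i}=\sqrt{-1}.$$ The fundamental frequencies are $\theta_\ell=\frac{2\pi\ell}{p}$, $1\leq\ell\leq\lfloor p/2\rfloor$. For a set $\mathcal{F}\subset\{1,\ldots,\lfloor p/2\rfloor\}$, $\boldsymbol\theta=\{\theta_\ell\colon\ell\in\mathcal{F}\}$ and $I_Z(\boldsymbol\theta)$ is the vector $(I_Z(\theta_\ell))_{\ell\in\mathcal{F}}\in\mathbb{R}^f$. Both $\mathcal{F}$ (hence $f$) and $p$ may depend on $T$. Here $\gamma_U(h)=\mathrm{Cov}(U_{t,i+h},U_{ti})$. If $\psi_T=0$, the quotient $x/\psi_T$ is read as $+\infty$ for $x>0$. Random variables $Z_T\to\infty$ in probability if $P(Z_T>K)\to1$ for every $K$.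
   Formalization: Part (i) is proved under the added condition p(T)→∞; for bounded p it can fail (p=4, F={1,2}, Gaussian process whose only nonzero autocovariances are γ(0) and small γ(±5)). Part (ii) needs no such condition. *)

theory Defs
  imports "HOL-Probability.Probability"
begin

definition covar :: "'a measure \<Rightarrow> ('a \<Rightarrow> real) \<Rightarrow> ('a \<Rightarrow> real) \<Rightarrow> real" where
  "covar M X Y = (\<integral>\<omega>. (X \<omega> - (\<integral>\<eta>. X \<eta> \<partial>M)) * (Y \<omega> - (\<integral>\<eta>. Y \<eta> \<partial>M)) \<partial>M)"

(* Second-order stationarity of a process X 1, X 2, ...; the component X 0 is never used.
   A strictly stationary process with finite second moments satisfies it. *)
definition stationary_process :: "'a measure \<Rightarrow> (nat \<Rightarrow> 'a \<Rightarrow> real) \<Rightarrow> bool" where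
  "stationary_process M X \<longleftrightarrow>
     (\<forall>i\<ge>1. X i \<in> borel_measurable M \<and> integrable M (\<lambda>\<omega>. (X i \<omega>)\<^sup>2)) \<and>
     (\<forall>i\<ge>1. (\<integral>\<omega>. X i \<omega> \<partial>M) = (\<integral>\<omega>. X 1 \<omega> \<partial>M)) \<and>
     (\<forall>i\<ge>1. \<forall>h. covar M (X (i + h)) (X i) = covar M (X (1 + h)) (X 1))"

(* Cov (X (i + h), X i) for the least index i \<ge> 1 with i + h \<ge> 1. *)
definition autocov :: "'a measure \<Rightarrow> (nat \<Rightarrow> 'a \<Rightarrow> real) \<Rightarrow> int \<Rightarrow> real" where
  "autocov M X h = covar M (X (1 + nat h)) (X (1 + nat (- h)))"

(* For absolutely summable autocovariances the sum converges and is real, because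
   autocov is even in h. *)
definition spectral_density :: "'a measure \<Rightarrow> (nat \<Rightarrow> 'a \<Rightarrow> real) \<Rightarrow> real \<Rightarrow> real" where
  "spectral_density M X \<theta> =
     Re (\<Sum>\<^sub>\<infinity>h\<in>UNIV. complex_of_real (autocov M X h) * exp (\<i> * of_int h * of_real \<theta>))"

(* The processes (U t i)_{i \<ge> 1}, t \<ge> 1, as random elements of the product space
   R^{1,2,...} with its product sigma-algebra, are independent and equal in law. *)
definition iid_processes :: "'a measure \<Rightarrow> (nat \<Rightarrow> nat \<Rightarrow> 'a \<Rightarrow> real) \<Rightarrow> bool" where
  "iid_processes M U \<longleftrightarrow>
     (let S = (\<Pi>\<^sub>M i\<in>{1::nat..}. (borel :: real measure));
          path = (\<lambda>t \<omega>. \<lambda>i\<in>{1..}. U t i \<omega>)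
      in prob_space.indep_vars M (\<lambda>_. S) path {1..} \<and>
         (\<forall>t\<ge>1. distr M S (path t) = distr M S (path 1)))"

definition periodogram :: "nat \<Rightarrow> (nat \<Rightarrow> real) \<Rightarrow> real \<Rightarrow> real" where
  "periodogram p z \<theta> =
     1 / real p * (cmod (\<Sum>k=1..p. complex_of_real (z k) * exp (- \<i> * of_nat k * of_real \<theta>)))\<^sup>2"

definition fund_freq :: "nat \<Rightarrow> nat \<Rightarrow> real" where
  "fund_freq p l = 2 * pi * real l / real p"

definition emp_mean :: "nat set \<Rightarrow> (nat \<Rightarrow> real) \<Rightarrow> real" where
  "emp_mean F z = 1 / real (card F) * (\<Sum>l\<in>F. z l)"

definition emp_var :: "nat set \<Rightarrow> (nat \<Rightarrow> real) \<Rightarrow> real" where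
  "emp_var F z = 1 / (real (card F) - 1) * (\<Sum>l\<in>F. (z l - emp_mean F z)\<^sup>2)"

definition xi :: "(nat \<Rightarrow> nat \<Rightarrow> 'a \<Rightarrow> real) \<Rightarrow> nat \<Rightarrow> nat \<Rightarrow> 'a \<Rightarrow> nat \<Rightarrow> real" where
  "xi U p T \<omega> l = 1 / real T * (\<Sum>t=1..T. periodogram p (\<lambda>i. U t i \<omega>) (fund_freq p l))"

(* In the two test statistics, s2 is the value of the estimator of \<sigma>\<^sup>2. *)
definition Lambda_fin ::
  "(nat \<Rightarrow> nat \<Rightarrow> 'a \<Rightarrow> real) \<Rightarrow> nat \<Rightarrow> nat set \<Rightarrow> real \<Rightarrow> nat \<Rightarrow> 'a \<Rightarrow> real" where
  "Lambda_fin U p F s2 T \<omega> =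
     (real (card F) - 1) * real T * emp_var F (xi U p T \<omega>) / s2\<^sup>2"

definition Lambda_inf ::
  "(nat \<Rightarrow> nat \<Rightarrow> 'a \<Rightarrow> real) \<Rightarrow> nat \<Rightarrow> nat set \<Rightarrow> real \<Rightarrow> nat \<Rightarrow> 'a \<Rightarrow> real" where
  "Lambda_inf U p F s2 T \<omega> =
     (real T * emp_var F (xi U p T \<omega>) / s2\<^sup>2 - 1) * sqrt ((real (card F) - 1) / 2)"

definition tendsto_in_prob :: "'a measure \<Rightarrow> (nat \<Rightarrow> 'a \<Rightarrow> real) \<Rightarrow> real \<Rightarrow> bool" where
  "tendsto_in_prob M X c \<longleftrightarrow>
     (\<forall>\<epsilon>>0. (\<lambda>T. measure M {\<omega> \<in> space M. \<bar>X T \<omega> - c\<bar> > \<epsilon>}) \<longlonglongrightarrow> 0)"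

(* Extended-real valued, so that it applies to quotients x / \<psi>: in ereal, x / 0 = \<infinity>
   for x > 0. *)
definition tendsto_infinity_in_prob :: "'a measure \<Rightarrow> (nat \<Rightarrow> 'a \<Rightarrow> ereal) \<Rightarrow> bool" where
  "tendsto_infinity_in_prob M Z \<longleftrightarrow>
     (\<forall>K::real. (\<lambda>T. measure M {\<omega> \<in> space M. Z T \<omega> > ereal K}) \<longlonglongrightarrow> 1)"

end

(* The quantity S^2 is, up to the factor 1 / (f - 1), the squared distance of xi from the constant
   vectors, so that S^2 >= (empirical variance of g) / 2 - |xi - g|^2 / (f - 1). The expectation of
   |xi - g|^2 / (f - 1) is an average, up to a factor f / (f - 1) <= 2, of the terms
   Var I / T + (E I - g)^2, where E I -> g uniformly in the frequency because E I is a Cesaro mean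
   of the absolutely summable series g. By Markov's inequality S^2 / sigma_hat^4 is therefore
   bounded below by a positive constant with probability tending to 1, which makes Lambda_fin of
   order at least T and Lambda_inf of order at least T sqrt f. *)
theory Submission
  imports Defs
begin

section \<open>Inequalities for the empirical variance\<close>

text \<open>Expanding the square, centring at the mean lowers the sum of squares by exactly
  \<open>real (card F) * (emp_mean F z)\<^sup>2\<close>.\<close>

lemma sum_diff_emp_mean_sq_le:
  assumes "finite F" "F \<noteq> {}"
  shows "(\<Sum>l\<in>F. (z l - emp_mean F z)\<^sup>2) \<le> (\<Sum>l\<in>F. (z l)\<^sup>2)"
proof -
  have c: "real (card F) > 0" using assms by (simp add: card_gt_0_iff)
  have s: "(\<Sum>l\<in>F. z l) = real (card F) * emp_mean F z"
    using c by (simp add: emp_mean_def)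
  have "(\<Sum>l\<in>F. (z l - emp_mean F z)\<^sup>2)
      = (\<Sum>l\<in>F. (z l)\<^sup>2) + real (card F) * (emp_mean F z)\<^sup>2 - 2 * emp_mean F z * (\<Sum>l\<in>F. z l)"
    by (simp add: power2_diff sum.distrib sum_subtractf sum_distrib_left sum_distrib_right mult_ac)
  also have "\<dots> = (\<Sum>l\<in>F. (z l)\<^sup>2) - real (card F) * (emp_mean F z)\<^sup>2"
    unfolding s by (simp add: power2_eq_square)
  finally show ?thesis using c by simp
qed

text \<open>Centring is linear, so (a - b)^2 <= 2 a^2 + 2 b^2 applies to the centred
  \<open>x\<close> and the centred difference \<open>x - y\<close>. With \<open>x\<close> the
  averaged periodogram and \<open>y\<close> the spectral density, this bounds the empirical variance
  of \<open>x\<close> from below.\<close>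

lemma emp_var_le_twice_emp_var_plus:
  assumes "card F \<ge> 2"
  shows "emp_var F y \<le> 2 * emp_var F x + 2 / (real (card F) - 1) * (\<Sum>l\<in>F. (x l - y l)\<^sup>2)"
proof -
  have fin: "finite F" "F \<noteq> {}" using assms card.infinite by fastforce+
  have c: "real (card F) - 1 > 0" using assms by simp
  define d where "d = (\<lambda>l. x l - y l)"
  have m: "emp_mean F y = emp_mean F x - emp_mean F d"
    by (simp add: emp_mean_def d_def sum_subtractf algebra_simps)
  have "(y l - emp_mean F y)\<^sup>2 \<le> 2 * (x l - emp_mean F x)\<^sup>2 + 2 * (d l - emp_mean F d)\<^sup>2" for l
  proof -
    have "(a - b)\<^sup>2 \<le> 2 * a\<^sup>2 + 2 * b\<^sup>2" for a b :: real
      using zero_le_power2[of "a + b"] by (simp add: power2_sum power2_diff)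
    from this[of "x l - emp_mean F x" "d l - emp_mean F d"] show ?thesis
      unfolding m by (simp add: d_def algebra_simps)
  qed
  then have "(\<Sum>l\<in>F. (y l - emp_mean F y)\<^sup>2)
      \<le> (\<Sum>l\<in>F. 2 * (x l - emp_mean F x)\<^sup>2 + 2 * (d l - emp_mean F d)\<^sup>2)"
    by (rule sum_mono)
  also have "\<dots> = 2 * (\<Sum>l\<in>F. (x l - emp_mean F x)\<^sup>2) + 2 * (\<Sum>l\<in>F. (d l - emp_mean F d)\<^sup>2)"
    by (simp add: sum.distrib sum_distrib_left)
  also have "\<dots> \<le> 2 * (\<Sum>l\<in>F. (x l - emp_mean F x)\<^sup>2) + 2 * (\<Sum>l\<in>F. (d l)\<^sup>2)"
    using sum_diff_emp_mean_sq_le[OF fin, of d] by simp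
  finally show ?thesis
    using c by (simp add: emp_var_def d_def divide_simps)
qed

section \<open>The periodogram and the spectral density as cosine sums\<close>

text \<open>The squared modulus splits into squared real and imaginary parts, whose products merge
  by the formula for \<open>cos (a - b)\<close>. In this real quadratic form expectations and
  measurability can be treated term by term.\<close>

lemma periodogram_eq_sum_cos:
  "periodogram p z \<theta> =
     1 / real p * (\<Sum>k=1..p. \<Sum>j=1..p. z j * z k * cos (real_of_int (int j - int k) * \<theta>))"
proof -
  define s where "s = (\<Sum>k=1..p. complex_of_real (z k) * exp (- \<i> * of_nat k * of_real \<theta>))"
  have e: "exp (- \<i> * of_nat k * of_real \<theta>) = cis (- (real k * \<theta>))" for k
    by (simp add: cis_conv_exp algebra_simps)
  have re: "Re s = (\<Sum>k=1..p. z k * cos (real k * \<theta>))"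
    and im: "Im s = - (\<Sum>k=1..p. z k * sin (real k * \<theta>))"
    unfolding s_def e by (simp_all add: sum_negf)
  have "(cmod s)\<^sup>2 = (\<Sum>k=1..p. z k * cos (real k * \<theta>))\<^sup>2 + (\<Sum>k=1..p. z k * sin (real k * \<theta>))\<^sup>2"
    by (simp add: cmod_power2 re im)
  also have "\<dots> = (\<Sum>k=1..p. \<Sum>j=1..p. z j * z k * cos (real_of_int (int j - int k) * \<theta>))"
    by (simp add: power2_eq_square sum_product left_diff_distrib cos_diff
        flip: sum.distrib) (simp add: algebra_simps)
  finally show ?thesis by (simp add: periodogram_def s_def)
qed

(* For indices k at distance more than N from both ends of {1..p}, the inner sum contains all
   lags up to N, so it differs from the full series by a tail; the at most 2 N remaining indices
   are negligible after division by p. *)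
lemma Cesaro_cos_sums_uniform_limit:
  fixes \<gamma> :: "int \<Rightarrow> real"
  assumes summ: "(\<lambda>h. \<bar>\<gamma> h\<bar>) summable_on UNIV" and "\<epsilon> > 0"
  shows "\<forall>\<^sub>F p in at_top. \<forall>\<theta>.
    \<bar>1 / real p * (\<Sum>k=1..p. \<Sum>j=1..p. \<gamma> (int j - int k) * cos (real_of_int (int j - int k) * \<theta>))
     - (\<Sum>\<^sub>\<infinity>h. \<gamma> h * cos (real_of_int h * \<theta>))\<bar> \<le> \<epsilon>"
proof -
  define A where "A = (\<Sum>\<^sub>\<infinity>h. \<bar>\<gamma> h\<bar>)"
  have A0: "A \<ge> 0" unfolding A_def by (simp add: infsum_nonneg)
  \<comment> \<open>\<open>N0\<close> carries all but \<open>\<epsilon> / 2\<close> of the absolute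
    mass \<open>A\<close>; the other half of the error is kept for the boundary indices.\<close>
  obtain N0 where N0: "finite N0" "\<bar>(\<Sum>h\<in>N0. \<bar>\<gamma> h\<bar>) - A\<bar> \<le> \<epsilon> / 2"
    using infsum_finite_approximation[OF summ, of "\<epsilon> / 2"] \<open>\<epsilon> > 0\<close>
    by (auto simp: A_def dist_real_def)
  \<comment> \<open>Every lag in \<open>N0\<close> has modulus at most \<open>N\<close>. The
    inserted 0 keeps \<open>Max\<close> meaningful when \<open>N0\<close> is empty.\<close>
  define N where "N = nat (Max (insert 0 (abs ` N0)))"
  have N: "N0 \<subseteq> {- int N..int N}"
  proof
    fix h assume "h \<in> N0"
    then have "\<bar>h\<bar> \<le> Max (insert 0 (abs ` N0))" using N0(1) by auto
    then show "h \<in> {- int N..int N}" by (auto simp: N_def)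
  qed
  \<comment> \<open>Error of a single row \<open>k\<close>: only the tail for interior
    \<open>k\<close>, with the crude bound \<open>A\<close> added near the ends. It holds for every
    \<open>k\<close>, also outside \<open>{1..p}\<close>.\<close>
  have main: "\<bar>(\<Sum>j=1..p. \<gamma> (int j - int k) * cos (real_of_int (int j - int k) * \<theta>))
      - (\<Sum>\<^sub>\<infinity>h. \<gamma> h * cos (real_of_int h * \<theta>))\<bar>
      \<le> \<epsilon> / 2 + (if k \<le> N \<or> p < k + N then A else 0)" for k p \<theta>
  proof -
    \<comment> \<open>\<open>B\<close> collects the lags occurring in row \<open>k\<close>; the row
      differs from the full series exactly by the lags outside \<open>B\<close>.\<close>
    define B where "B = (\<lambda>j. int j - int k) ` {1..p}"
    let ?f = "\<lambda>h. \<gamma> h * cos (real_of_int h * \<theta>)"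
    have fB: "finite B" by (simp add: B_def)
    have abs_le: "\<bar>?f h\<bar> \<le> \<bar>\<gamma> h\<bar>" for h
      by (simp add: abs_mult mult_left_le)
    have summf: "?f summable_on X" "(\<lambda>h. \<bar>?f h\<bar>) summable_on X"
      "(\<lambda>h. \<bar>\<gamma> h\<bar>) summable_on X" for X
    proof -
      show 1: "(\<lambda>h. \<bar>\<gamma> h\<bar>) summable_on X"
        using summ summable_on_subset_banach by blast
      have "(\<lambda>h. norm (?f h)) summable_on X"
        by (rule Infinite_Sum.abs_summable_on_comparison_test[where g = \<gamma>]) (use 1 abs_le in auto)
      then show "?f summable_on X" "(\<lambda>h. \<bar>?f h\<bar>) summable_on X"
        using abs_summable_summable[of ?f X] by auto
    qed
    have split: "infsum F UNIV = sum F B + infsum F (- B)"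
      if "\<And>X. F summable_on X" for F :: "int \<Rightarrow> real"
      using infsum_Un_disjoint[of F B "- B"] that fB by simp
    have "(\<Sum>j=1..p. \<gamma> (int j - int k) * cos (real_of_int (int j - int k) * \<theta>)) = sum ?f B"
      unfolding B_def by (subst sum.reindex) (auto simp: inj_on_def)
    then have "\<bar>(\<Sum>j=1..p. \<gamma> (int j - int k) * cos (real_of_int (int j - int k) * \<theta>))
      - (\<Sum>\<^sub>\<infinity>h. ?f h)\<bar> = \<bar>infsum ?f (- B)\<bar>"
      using split[of ?f] summf by simp
    also have "\<dots> \<le> (\<Sum>\<^sub>\<infinity>h\<in>-B. \<bar>?f h\<bar>)"
      using norm_infsum_bound[of ?f "- B"] summf by simp
    also have "\<dots> \<le> (\<Sum>\<^sub>\<infinity>h\<in>-B. \<bar>\<gamma> h\<bar>)"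
      using abs_le by (intro infsum_mono summf)
    also have "\<dots> = A - (\<Sum>h\<in>B. \<bar>\<gamma> h\<bar>)"
      using split[of "\<lambda>h. \<bar>\<gamma> h\<bar>"] summf by (simp add: A_def)
    also have "\<dots> \<le> \<epsilon> / 2 + (if k \<le> N \<or> p < k + N then A else 0)"
    proof (cases "k \<le> N \<or> p < k + N")
      case True
      have "(\<Sum>h\<in>B. \<bar>\<gamma> h\<bar>) \<ge> 0" by (simp add: sum_nonneg)
      with True \<open>\<epsilon> > 0\<close> show ?thesis by (simp only: if_True)
    next
      case False
      \<comment> \<open>Here \<open>N < k\<close> and \<open>k + N \<le> p\<close>, so a lag
        \<open>h\<close> of modulus at most \<open>N\<close> is attained at the index
        \<open>h + k\<close> inside \<open>{1..p}\<close>.\<close>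
      have "{- int N..int N} \<subseteq> B"
      proof
        fix h assume "h \<in> {- int N..int N}"
        then have "h = int (nat (h + int k)) - int k" "nat (h + int k) \<in> {1..p}"
          using False by auto
        then show "h \<in> B" unfolding B_def by blast
      qed
      then have "(\<Sum>h\<in>N0. \<bar>\<gamma> h\<bar>) \<le> (\<Sum>h\<in>B. \<bar>\<gamma> h\<bar>)"
        using N fB by (intro sum_mono2) auto
      moreover have "A - (\<Sum>h\<in>N0. \<bar>\<gamma> h\<bar>) \<le> \<epsilon> / 2" using N0(2) by linarith
      ultimately show ?thesis using False by simp
    qed
    finally show ?thesis .
  qed
  have "\<forall>\<^sub>F p in at_top. 2 * real N * A / (\<epsilon> / 2) \<le> real p"
    using filterlim_real_sequentially by (simp add: filterlim_at_top)
  then show ?thesis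
    using eventually_ge_at_top[of 1]
  proof eventually_elim
    case (elim p)
    have p: "real p > 0" using elim by simp
    \<comment> \<open>For such \<open>p\<close> the at most \<open>2 * N\<close> boundary rows, at
      cost \<open>A\<close> each, add at most \<open>\<epsilon> / 2\<close> to the average.\<close>
    have pA: "2 * real N * A \<le> \<epsilon> / 2 * real p"
      using elim \<open>\<epsilon> > 0\<close> by (simp add: field_simps)
    \<comment> \<open>Stated for arbitrary \<open>S\<close> and \<open>L\<close>: the threshold on
      \<open>p\<close> involves only \<open>N\<close>, \<open>A\<close> and
      \<open>\<epsilon>\<close>, which makes the estimate uniform in
      \<open>\<theta>\<close>.\<close>
    have average: "\<bar>1 / real p * (\<Sum>k=1..p. S k) - L\<bar> \<le> \<epsilon>"
      if S: "\<And>k. \<bar>S k - L\<bar> \<le> \<epsilon> / 2 + (if k \<le> N \<or> p < k + N then A else 0)"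
      for S :: "nat \<Rightarrow> real" and L :: real
    proof -
      \<comment> \<open>Subtraction is truncated: for \<open>N > p + 1\<close> the second interval
        is \<open>{0..p}\<close>, which still has at most \<open>N\<close> elements.\<close>
      have sub: "{k\<in>{1..p}. k \<le> N \<or> p < k + N} \<subseteq> {1..N} \<union> {p+1-N..p}" by auto
      have "card ({1..N} \<union> {p+1-N..p}) \<le> 2 * N"
        using card_Un_le[of "{1..N}" "{p+1-N..p}"] by auto
      then have cb: "card {k\<in>{1..p}. k \<le> N \<or> p < k + N} \<le> 2 * N"
        using card_mono[OF _ sub] by force
      have "(\<Sum>k=1..p. S k) - real p * L = (\<Sum>k=1..p. S k - L)"
        by (simp add: sum_subtractf)
      then have "\<bar>(\<Sum>k=1..p. S k) - real p * L\<bar>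
          \<le> (\<Sum>k=1..p. \<epsilon> / 2 + (if k \<le> N \<or> p < k + N then A else 0))"
        using S by (auto intro!: order_trans[OF sum_abs] sum_mono)
      also have "\<dots> = real p * (\<epsilon> / 2) + real (card {k\<in>{1..p}. k \<le> N \<or> p < k + N}) * A"
        by (simp add: sum.distrib flip: sum.inter_filter)
      also have "\<dots> \<le> real p * (\<epsilon> / 2) + real (2 * N) * A"
        using cb A0 by (intro add_left_mono mult_right_mono) auto
      also have "\<dots> \<le> real p * \<epsilon>" using pA by (simp add: algebra_simps)
      finally have "\<bar>(\<Sum>k=1..p. S k) - real p * L\<bar> / real p \<le> \<epsilon>"
        using p by (simp add: field_simps)
      moreover have "\<bar>(\<Sum>k=1..p. S k) - real p * L\<bar> / real p = \<bar>1 / real p * (\<Sum>k=1..p. S k) - L\<bar>"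
      proof -
        have "1 / real p * (\<Sum>k=1..p. S k) - L = ((\<Sum>k=1..p. S k) - real p * L) / real p"
          using p by (simp add: field_simps)
        then show ?thesis using p by (simp add: abs_divide)
      qed
      ultimately show ?thesis by simp
    qed
    show ?case by (intro allI average main)
  qed
qed

text \<open>Absolute summability lets the real part pass through the series, and \<open>cis\<close>
  has real part \<open>cos\<close>. This is the form in which the limit of the Cesaro sums
  appears.\<close>

lemma spectral_density_eq_infsum_cos:
  assumes "(\<lambda>h. \<bar>autocov M X h\<bar>) summable_on UNIV"
  shows "spectral_density M X \<theta> = (\<Sum>\<^sub>\<infinity>h. autocov M X h * cos (real_of_int h * \<theta>))"
proof -
  let ?f = "\<lambda>h::int. complex_of_real (autocov M X h) * exp (\<i> * of_int h * of_real \<theta>)"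
  have e: "exp (\<i> * of_int h * of_real \<theta>) = cis (real_of_int h * \<theta>)" for h
    by (simp add: cis_conv_exp algebra_simps)
  have "(\<lambda>h. norm (?f h)) summable_on UNIV"
    using assms by (simp add: e norm_mult)
  then have "?f summable_on UNIV" by (rule abs_summable_summable)
  from infsum_Re[OF this] show ?thesis
    by (simp add: spectral_density_def e)
qed

section \<open>Expectation of the periodogram\<close>

lemma integrable_mult_of_squares:
  fixes f g :: "'a \<Rightarrow> real"
  assumes "f \<in> borel_measurable M" "g \<in> borel_measurable M"
    and "integrable M (\<lambda>x. (f x)\<^sup>2)" "integrable M (\<lambda>x. (g x)\<^sup>2)"
  shows "integrable M (\<lambda>x. f x * g x)"
proof (rule Bochner_Integration.integrable_bound)
  show "integrable M (\<lambda>x. (f x)\<^sup>2 + (g x)\<^sup>2)" using assms by simp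
  show "AE x in M. norm (f x * g x) \<le> norm ((f x)\<^sup>2 + (g x)\<^sup>2)"
  proof (intro always_eventually allI)
    fix x
    have "0 \<le> (\<bar>f x\<bar> - \<bar>g x\<bar>)\<^sup>2" by simp
    then have "2 * \<bar>f x * g x\<bar> \<le> (f x)\<^sup>2 + (g x)\<^sup>2"
      by (simp add: power2_diff abs_mult)
    then show "norm (f x * g x) \<le> norm ((f x)\<^sup>2 + (g x)\<^sup>2)" by simp
  qed
qed (use assms in simp)

text \<open>In the cosine expansion the products of mean-zero variables have covariances as
  expectations, and these depend on the lag alone. The result is the Cesaro sum that converges to
  the spectral density.\<close>

lemma expectation_periodogram:
  assumes stat: "stationary_process M X"
    and mean: "(\<integral>\<omega>. X 1 \<omega> \<partial>M) = 0"
  shows "(\<integral>\<omega>. periodogram p (\<lambda>i. X i \<omega>) \<theta> \<partial>M) = 1 / real p *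
    (\<Sum>k=1..p. \<Sum>j=1..p. autocov M X (int j - int k) * cos (real_of_int (int j - int k) * \<theta>))"
proof -
  have X: "X i \<in> borel_measurable M" "integrable M (\<lambda>\<omega>. (X i \<omega>)\<^sup>2)" "(\<integral>\<omega>. X i \<omega> \<partial>M) = 0"
    if "i \<ge> 1" for i
    using stat mean that unfolding stationary_process_def by metis+
  have st: "covar M (X (i + h)) (X i) = covar M (X (1 + h)) (X 1)" if "i \<ge> 1" for i h
    using stat that unfolding stationary_process_def by blast
  have comm: "covar M Y Z = covar M Z Y" for Y Z
    by (simp add: covar_def mult.commute)
  have E: "(\<integral>\<omega>. X j \<omega> * X k \<omega> \<partial>M) = autocov M X (int j - int k)" if "j \<ge> 1" "k \<ge> 1" for j k
  proof -
    have "(\<integral>\<omega>. X j \<omega> * X k \<omega> \<partial>M) = covar M (X j) (X k)"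
      using X(3) that by (simp add: covar_def)
    also have "\<dots> = autocov M X (int j - int k)"
    \<comment> \<open>Stationarity is given for nonnegative lags; for \<open>k > j\<close> the
      symmetry of \<open>covar\<close> swaps the pair, in agreement with the encoding of negative
      lags in \<open>autocov\<close>.\<close>
    proof (cases "k \<le> j")
      case True
      then show ?thesis using st[of k "j - k"] that by (simp add: autocov_def nat_diff_distrib)
    next
      case False
      then show ?thesis using st[of j "k - j"] comm that by (simp add: autocov_def nat_diff_distrib)
    qed
    finally show ?thesis .
  qed
  have I: "integrable M (\<lambda>\<omega>. X j \<omega> * X k \<omega>)" if "j \<ge> 1" "k \<ge> 1" for j k
    using X that by (intro integrable_mult_of_squares) auto
  let ?c = "\<lambda>j k. cos (real_of_int (int j - int k) * \<theta>)"
  have J: "integrable M (\<lambda>\<omega>. X j \<omega> * X k \<omega> * ?c j k)"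
    "(\<integral>\<omega>. X j \<omega> * X k \<omega> * ?c j k \<partial>M) = autocov M X (int j - int k) * ?c j k"
    if "j \<ge> 1" "k \<ge> 1" for j k
    using I[OF that] E[OF that] by simp_all
  have "(\<integral>\<omega>. (\<Sum>k=1..p. \<Sum>j=1..p. X j \<omega> * X k \<omega> * ?c j k) \<partial>M)
      = (\<Sum>k=1..p. \<integral>\<omega>. (\<Sum>j=1..p. X j \<omega> * X k \<omega> * ?c j k) \<partial>M)"
    by (intro Bochner_Integration.integral_sum Bochner_Integration.integrable_sum J) auto
  also have "\<dots> = (\<Sum>k=1..p. \<Sum>j=1..p. \<integral>\<omega>. X j \<omega> * X k \<omega> * ?c j k \<partial>M)"
    by (intro sum.cong refl Bochner_Integration.integral_sum J) auto
  also have "\<dots> = (\<Sum>k=1..p. \<Sum>j=1..p. autocov M X (int j - int k) * ?c j k)"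
    by (intro sum.cong refl J) auto
  finally show ?thesis
    unfolding periodogram_eq_sum_cos by (simp only: integral_mult_right_zero)
qed

section \<open>Mean square error of averages of independent copies\<close>

text \<open>Bias-variance decomposition about \<open>c\<close>: by independence only the
  \<open>T\<close> diagonal terms of the squared sum survive. \<open>X\<close> takes values in an
  arbitrary space, so that whole paths of a process can be inserted.\<close>

lemma (in prob_space) expectation_sq_average_deviation:
  fixes h :: "'b \<Rightarrow> real"
  assumes ind: "indep_vars (\<lambda>_. S) X {1::nat..}"
    and same: "\<And>t. t \<ge> 1 \<Longrightarrow> distr M S (X t) = distr M S (X 1)"
    and h: "h \<in> borel_measurable S"
    and sq: "integrable M (\<lambda>\<omega>. (h (X 1 \<omega>))\<^sup>2)"
    and T: "T \<ge> 1"
  shows "integrable M (\<lambda>\<omega>. (1 / real T * (\<Sum>t=1..T. h (X t \<omega>)) - c)\<^sup>2)" (is ?A)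
    and "expectation (\<lambda>\<omega>. (1 / real T * (\<Sum>t=1..T. h (X t \<omega>)) - c)\<^sup>2)
      = variance (\<lambda>\<omega>. h (X 1 \<omega>)) / real T + (expectation (\<lambda>\<omega>. h (X 1 \<omega>)) - c)\<^sup>2" (is ?B)
proof -
  have rv: "X t \<in> measurable M S" if "t \<ge> 1" for t
    using ind that unfolding indep_vars_def by auto
  have hm: "(\<lambda>\<omega>. h (X t \<omega>)) \<in> borel_measurable M" if "t \<ge> 1" for t
    using measurable_compose[OF rv[OF that] h] .
  define m where "m = expectation (\<lambda>\<omega>. h (X 1 \<omega>))"
  define Y where "Y = (\<lambda>t \<omega>. h (X t \<omega>) - m)"
  \<comment> \<open>Integrability and expectation of \<open>k (X t)\<close> depend only on the law
    of \<open>X t\<close>, which is that of \<open>X 1\<close>.\<close>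
  have transf: "integrable M (\<lambda>\<omega>. k (X t \<omega>)) = integrable M (\<lambda>\<omega>. k (X 1 \<omega>))"
    "expectation (\<lambda>\<omega>. k (X t \<omega>)) = expectation (\<lambda>\<omega>. k (X 1 \<omega>))"
    if t: "t \<ge> 1" and k: "k \<in> borel_measurable S" for t and k :: "'b \<Rightarrow> real"
    unfolding integrable_distr_eq[OF rv[OF t] k, symmetric]
      integrable_distr_eq[OF rv[OF order_refl] k, symmetric]
      integral_distr[OF rv[OF t] k, symmetric] integral_distr[OF rv[OF order_refl] k, symmetric]
      same[OF t] by (rule refl)+
  have int1: "integrable M (\<lambda>\<omega>. h (X 1 \<omega>))"
    using square_integrable_imp_integrable[OF hm sq] by simp
  have Yint: "integrable M (Y t)" "expectation (Y t) = 0" if "t \<ge> 1" for t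
    using transf[OF that h] int1 by (simp_all add: Y_def m_def prob_space)
  have Y2: "integrable M (\<lambda>\<omega>. (Y t \<omega>)\<^sup>2)"
    "expectation (\<lambda>\<omega>. (Y t \<omega>)\<^sup>2) = variance (\<lambda>\<omega>. h (X 1 \<omega>))" if "t \<ge> 1" for t
  proof -
    have "(\<lambda>x. (h x - m)\<^sup>2) \<in> borel_measurable S" using h by measurable
    note * = transf[OF that this]
    have "integrable M (\<lambda>\<omega>. (h (X 1 \<omega>) - m)\<^sup>2)"
      unfolding power2_diff using sq int1 by simp
    with * show "integrable M (\<lambda>\<omega>. (Y t \<omega>)\<^sup>2)"
      "expectation (\<lambda>\<omega>. (Y t \<omega>)\<^sup>2) = variance (\<lambda>\<omega>. h (X 1 \<omega>))"
      by (simp_all add: Y_def m_def)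
  qed
  have Yprod: "integrable M (\<lambda>\<omega>. Y s \<omega> * Y t \<omega>)"
    "expectation (\<lambda>\<omega>. Y s \<omega> * Y t \<omega>) = (if s = t then variance (\<lambda>\<omega>. h (X 1 \<omega>)) else 0)"
    if "s \<ge> 1" "t \<ge> 1" for s t
  proof -
    have "indep_vars (\<lambda>_. borel) Y {1..}"
      unfolding Y_def using ind
      by (rule indep_vars_compose2[where Y = "\<lambda>_ x. h x - m"]) (use h in measurable)
    then have iv: "indep_vars (\<lambda>_. borel) Y {s, t}"
      by (rule indep_vars_subset) (use that in auto)
    have "integrable M (\<lambda>\<omega>. Y s \<omega> * Y t \<omega>)" "expectation (\<lambda>\<omega>. Y s \<omega> * Y t \<omega>) = 0" if "s \<noteq> t"
      using indep_vars_integrable[OF _ iv] indep_vars_lebesgue_integral[OF _ iv] Yint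
        \<open>s \<ge> 1\<close> \<open>t \<ge> 1\<close> that by auto
    with Y2[of t] that show "integrable M (\<lambda>\<omega>. Y s \<omega> * Y t \<omega>)"
      "expectation (\<lambda>\<omega>. Y s \<omega> * Y t \<omega>) = (if s = t then variance (\<lambda>\<omega>. h (X 1 \<omega>)) else 0)"
      by (cases "s = t"; simp add: power2_eq_square)+
  qed
  \<comment> \<open>With centred \<open>Y\<close> the deviation is the average of \<open>Y\<close>
    plus the bias \<open>m - c\<close>; the cross term is linear in \<open>Y\<close> and has
    expectation 0.\<close>
  have avg: "(1 / real T * (\<Sum>t=1..T. h (X t \<omega>)) - c)\<^sup>2 =
      (1 / real T)\<^sup>2 * (\<Sum>s=1..T. \<Sum>t=1..T. Y s \<omega> * Y t \<omega>)
      + 2 * (m - c) / real T * (\<Sum>t=1..T. Y t \<omega>) + (m - c)\<^sup>2" for \<omega>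
  proof -
    have "1 / real T * (\<Sum>t=1..T. h (X t \<omega>)) - c = 1 / real T * (\<Sum>t=1..T. Y t \<omega>) + (m - c)"
      using T by (simp add: Y_def sum_subtractf field_simps)
    moreover have "(1 / real T * R + d)\<^sup>2 = (1 / real T)\<^sup>2 * (R * R) + 2 * d / real T * R + d\<^sup>2" for R d
      by (simp add: power2_eq_square algebra_simps)
    ultimately show ?thesis by (simp only: sum_product)
  qed
  let ?D = "\<lambda>\<omega>. \<Sum>s=1..T. \<Sum>t=1..T. Y s \<omega> * Y t \<omega>"
  have D: "integrable M ?D" "expectation ?D = real T * variance (\<lambda>\<omega>. h (X 1 \<omega>))"
  proof -
    show "integrable M ?D" using Yprod(1) by (intro Bochner_Integration.integrable_sum) auto
    have "expectation ?D = (\<Sum>s=1..T. \<Sum>t=1..T. expectation (\<lambda>\<omega>. Y s \<omega> * Y t \<omega>))"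
      by (subst Bochner_Integration.integral_sum, intro Bochner_Integration.integrable_sum Yprod(1), simp, simp)
        (intro sum.cong refl Bochner_Integration.integral_sum Yprod(1), simp_all)
    also have "\<dots> = (\<Sum>s=1..T. \<Sum>t=1..T. if s = t then variance (\<lambda>\<omega>. h (X 1 \<omega>)) else 0)"
      by (intro sum.cong refl Yprod(2)) simp_all
    also have "\<dots> = (\<Sum>s=1..T. variance (\<lambda>\<omega>. h (X 1 \<omega>)))"
      by (intro sum.cong refl) simp
    also have "\<dots> = real T * variance (\<lambda>\<omega>. h (X 1 \<omega>))" by (simp only: sum_constant card_atLeastAtMost) simp
    finally show "expectation ?D = real T * variance (\<lambda>\<omega>. h (X 1 \<omega>))" .
  qed
  have L: "integrable M (\<lambda>\<omega>. \<Sum>t=1..T. Y t \<omega>)" "expectation (\<lambda>\<omega>. \<Sum>t=1..T. Y t \<omega>) = 0"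
  proof -
    show "integrable M (\<lambda>\<omega>. \<Sum>t=1..T. Y t \<omega>)"
      using Yint(1) by (intro Bochner_Integration.integrable_sum) auto
    have "expectation (\<lambda>\<omega>. \<Sum>t=1..T. Y t \<omega>) = (\<Sum>t=1..T. expectation (Y t))"
      by (rule Bochner_Integration.integral_sum) (use Yint(1) in auto)
    also have "\<dots> = 0" by (rule sum.neutral) (use Yint(2) in auto)
    finally show "expectation (\<lambda>\<omega>. \<Sum>t=1..T. Y t \<omega>) = 0" .
  qed
  show ?A unfolding avg using D(1) L(1) by simp
  have "expectation (\<lambda>\<omega>. (1 / real T * (\<Sum>t=1..T. h (X t \<omega>)) - c)\<^sup>2)
      = (1 / real T)\<^sup>2 * expectation ?D
      + 2 * (m - c) / real T * expectation (\<lambda>\<omega>. \<Sum>t=1..T. Y t \<omega>) + (m - c)\<^sup>2"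
    unfolding avg using D(1) L(1) by (simp add: prob_space)
  then show ?B using T unfolding D(2) L(2) by (simp add: m_def power2_eq_square)
qed

section \<open>Measurability and mean square error of the averaged periodogram\<close>

text \<open>The general family \<open>z\<close> covers two uses: the variables \<open>U t i\<close>,
  and the coordinates of path space, where only indices from 1 on exist.\<close>

lemma measurable_periodogram:
  assumes "\<And>k. k \<ge> 1 \<Longrightarrow> (\<lambda>x. z x k) \<in> borel_measurable N"
  shows "(\<lambda>x. periodogram p (z x) \<theta>) \<in> borel_measurable N"
  unfolding periodogram_eq_sum_cos using assms by (intro borel_measurable_times borel_measurable_sum) auto

lemma measurable_emp_var:
  assumes "\<And>l. l \<in> F \<Longrightarrow> (\<lambda>x. z x l) \<in> borel_measurable N"
  shows "(\<lambda>x. emp_var F (z x)) \<in> borel_measurable N"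
  unfolding emp_var_def emp_mean_def
  by (intro borel_measurable_times borel_measurable_sum borel_measurable_power
      borel_measurable_diff borel_measurable_const assms)

lemma (in prob_space) iid_processes_measurable:
  assumes "iid_processes M U" "t \<ge> 1" "i \<ge> 1"
  shows "U t i \<in> borel_measurable M"
proof -
  let ?S = "\<Pi>\<^sub>M i\<in>{1::nat..}. (borel :: real measure)"
  have "(\<lambda>\<omega>. \<lambda>i\<in>{1..}. U t i \<omega>) \<in> measurable M ?S"
    using assms(1,2) by (auto simp: iid_processes_def Let_def indep_vars_def)
  from measurable_compose[OF this measurable_component_singleton[of i]] assms(3)
  show ?thesis by simp
qed

lemma (in prob_space) measurable_xi:
  assumes "iid_processes M U"
  shows "(\<lambda>\<omega>. xi U p T \<omega> l) \<in> borel_measurable M"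
  unfolding xi_def
  by (intro borel_measurable_times borel_measurable_sum measurable_periodogram)
    (auto intro: iid_processes_measurable[OF assms])

text \<open>The bias-variance decomposition for the i.i.d. paths, with the periodogram as a function
  on path space.\<close>

lemma (in prob_space) expectation_sq_xi_deviation:
  assumes iid: "iid_processes M U"
    and sq: "integrable M (\<lambda>\<omega>. (periodogram p (\<lambda>i. U 1 i \<omega>) (fund_freq p l))\<^sup>2)"
    and T: "T \<ge> 1"
  shows "integrable M (\<lambda>\<omega>. (xi U p T \<omega> l - c)\<^sup>2)"
    and "expectation (\<lambda>\<omega>. (xi U p T \<omega> l - c)\<^sup>2)
      = variance (\<lambda>\<omega>. periodogram p (\<lambda>i. U 1 i \<omega>) (fund_freq p l)) / real T
        + (expectation (\<lambda>\<omega>. periodogram p (\<lambda>i. U 1 i \<omega>) (fund_freq p l)) - c)\<^sup>2"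
proof -
  let ?S = "\<Pi>\<^sub>M i\<in>{1::nat..}. (borel :: real measure)"
  let ?path = "\<lambda>t \<omega>. \<lambda>i\<in>{1..}. U t i \<omega>"
  let ?h = "\<lambda>z. periodogram p z (fund_freq p l)"
  \<comment> \<open>Restricting a path to \<open>{1..}\<close> changes nothing, because the sum in
    the periodogram starts at 1.\<close>
  have h: "?h (?path t \<omega>) = ?h (\<lambda>i. U t i \<omega>)" for t \<omega>
    unfolding periodogram_def by simp
  have "?h \<in> borel_measurable ?S"
    by (intro measurable_periodogram measurable_component_singleton) simp
  note * = expectation_sq_average_deviation[where X = ?path and h = ?h, unfolded h,
      OF _ _ this sq T, of c, folded xi_def]
  have "indep_vars (\<lambda>_. ?S) ?path {1..}"
    "\<And>t. t \<ge> 1 \<Longrightarrow> distr M ?S (?path t) = distr M ?S (?path 1)"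
    using iid unfolding iid_processes_def Let_def by blast+
  from *[OF this] show "integrable M (\<lambda>\<omega>. (xi U p T \<omega> l - c)\<^sup>2)"
    "expectation (\<lambda>\<omega>. (xi U p T \<omega> l - c)\<^sup>2)
      = variance (\<lambda>\<omega>. ?h (\<lambda>i. U 1 i \<omega>)) / real T + (expectation (\<lambda>\<omega>. ?h (\<lambda>i. U 1 i \<omega>)) - c)\<^sup>2"
    by auto
qed

section \<open>Degenerate processes\<close>

text \<open>All variances agree and hence vanish, so each variable is 0 almost everywhere and every
  covariance is 0. This serves to exclude a zero variance under the alternative.\<close>

lemma stationary_process_null_autocov:
  assumes stat: "stationary_process M X"
    and mean: "(\<integral>\<omega>. X 1 \<omega> \<partial>M) = 0"
    and null: "(\<integral>\<omega>. (X 1 \<omega>)\<^sup>2 \<partial>M) = 0"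
  shows "autocov M X h = 0"
proof -
  have X: "X i \<in> borel_measurable M" "integrable M (\<lambda>\<omega>. (X i \<omega>)\<^sup>2)" "(\<integral>\<omega>. X i \<omega> \<partial>M) = 0"
    if "i \<ge> 1" for i
    using stat mean that unfolding stationary_process_def by metis+
  \<comment> \<open>Stationarity at lag 0 is the equality of the variances.\<close>
  have "covar M (X i) (X i) = 0" if "i \<ge> 1" for i
    using stat that null mean unfolding stationary_process_def
    by (metis (no_types, lifting) Nat.add_0_right covar_def Bochner_Integration.integral_cong
        diff_zero power2_eq_square)
  then have "(\<integral>\<omega>. (X i \<omega>)\<^sup>2 \<partial>M) = 0" if "i \<ge> 1" for i
    using X(3) that by (simp add: covar_def power2_eq_square)
  then have "AE \<omega> in M. X i \<omega> = 0" if "i \<ge> 1" for i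
    using integral_nonneg_eq_0_iff_AE[OF X(2)] that by auto
  then have "AE \<omega> in M. X (1 + nat h) \<omega> = 0" by simp
  then have "(\<integral>\<omega>. X (1 + nat h) \<omega> * X (1 + nat (- h)) \<omega> \<partial>M) = (\<integral>\<omega>. 0 \<partial>M)"
    by (intro integral_cong_AE borel_measurable_times X) auto
  then show ?thesis using X(3) by (simp add: autocov_def covar_def)
qed

section \<open>Divergence of quotients in probability\<close>

text \<open>For \<open>b = 0\<close> the quotient is infinite since \<open>x > 0\<close>; otherwise
  the gap between \<open>K\<close> and \<open>K'\<close> makes the inequality strict.\<close>

lemma ereal_divide_gt:
  assumes "K' * b \<le> x" "K < K'" "0 < x" "0 \<le> b"
  shows "ereal K < ereal x / ereal b"
proof (cases "b = 0")
  case True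
  then show ?thesis using assms by (simp add: divide_ereal_def zero_ereal_def[symmetric])
next
  case False
  then have "K' \<le> x / b" using assms by (simp add: pos_le_divide_eq)
  then show ?thesis using False assms by simp
qed

text \<open>Off the bad event \<open>L T\<close> is at least \<open>c * a T\<close>, which
  eventually exceeds any fixed multiple of \<open>\<psi> T\<close>. Both statistics are handled this
  way, with different rates \<open>a\<close>.\<close>

lemma (in prob_space) tendsto_infinity_in_prob_divideI:
  assumes meas: "\<And>T. T \<ge> 1 \<Longrightarrow> L T \<in> borel_measurable M"
    and bad: "\<And>T. T \<ge> 1 \<Longrightarrow> B T \<in> events" "(\<lambda>T. prob (B T)) \<longlonglongrightarrow> 0"
    and c: "c > 0"
    and a: "\<And>T. T \<ge> 1 \<Longrightarrow> a T > 0"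
    and lower: "\<forall>\<^sub>F T in sequentially. \<forall>\<omega>\<in>space M - B T. c * a T \<le> L T \<omega>"
    and \<psi>: "\<And>T. T \<ge> 1 \<Longrightarrow> 0 \<le> \<psi> T" "\<psi> \<in> o(a)"
  shows "tendsto_infinity_in_prob M (\<lambda>T \<omega>. ereal (L T \<omega>) / ereal (\<psi> T))"
  unfolding tendsto_infinity_in_prob_def
proof
  fix K :: real
  \<comment> \<open>Strictly above \<open>K\<close>, and positive so that \<open>c / K'\<close> is
    an admissible constant in the little-o bound.\<close>
  define K' where "K' = max K 0 + 1"
  have K': "K' > 0" "K < K'" by (auto simp: K'_def)
  let ?E = "\<lambda>T. {\<omega> \<in> space M. ereal K < ereal (L T \<omega>) / ereal (\<psi> T)}"
  have "\<forall>\<^sub>F T in sequentially. norm (\<psi> T) \<le> c / K' * norm (a T)"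
    using landau_o.smallD[OF \<psi>(2), of "c / K'"] c K' by simp
  then have ev: "\<forall>\<^sub>F T in sequentially. 1 - prob (B T) \<le> prob (?E T)"
    using lower eventually_ge_at_top[of 1]
  proof eventually_elim
    case (elim T)
    note [measurable] = meas[OF elim(3)]
    have E: "?E T \<in> events"
      unfolding divide_ereal_def by measurable
    have "K' * \<psi> T \<le> c * a T"
      using elim(1) \<psi>(1)[OF elim(3)] a[OF elim(3)] K' by (simp add: field_simps)
    moreover have "0 < c * a T" using c a[OF elim(3)] by simp
    ultimately have "ereal K < ereal (L T \<omega>) / ereal (\<psi> T)" if "\<omega> \<in> space M - B T" for \<omega>
      using elim(2) K'(2) \<psi>(1)[OF elim(3)] that
      by (intro ereal_divide_gt[of K']) (auto intro: order_trans less_le_trans)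
    then have "space M - B T \<subseteq> ?E T" by blast
    then have "prob (space M - B T) \<le> prob (?E T)" using E by (intro finite_measure_mono)
    then show ?case using prob_compl[OF bad(1)[OF elim(3)]] by simp
  qed
  show "(\<lambda>T. prob (?E T)) \<longlonglongrightarrow> 1"
  proof (rule tendsto_sandwich[OF ev])
    show "(\<lambda>T. 1 - prob (B T)) \<longlonglongrightarrow> 1" using tendsto_diff[OF tendsto_const bad(2), of 1] by simp
  qed (auto intro: prob_le_1)
qed

theorem proposition3p2:
  fixes M :: "'a measure"
    and U :: "nat \<Rightarrow> nat \<Rightarrow> 'a \<Rightarrow> real"
    and p :: "nat \<Rightarrow> nat"
    and F :: "nat \<Rightarrow> nat set"
    and \<sigma> :: real
    and sigma2_hat :: "nat \<Rightarrow> 'a \<Rightarrow> real"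
  assumes prob: "prob_space M"
    and iid: "iid_processes M U"
    and stat: "stationary_process M (U 1)"
    and mean: "(\<integral>\<omega>. U 1 1 \<omega> \<partial>M) = 0"
    and second: "(\<integral>\<omega>. (U 1 1 \<omega>)\<^sup>2 \<partial>M) = \<sigma>\<^sup>2"
    and fourth: "integrable M (\<lambda>\<omega>. (U 1 1 \<omega>) ^ 4)"
    and summ: "(\<lambda>h. \<bar>autocov M (U 1) h\<bar>) summable_on UNIV"
    and est_meas: "\<And>T. T \<ge> 1 \<Longrightarrow> sigma2_hat T \<in> borel_measurable M"
    and est_cons: "tendsto_in_prob M sigma2_hat (\<sigma>\<^sup>2)"
    and freqs: "\<And>T. T \<ge> 1 \<Longrightarrow> F T \<subseteq> {1..p T div 2}"
    and card: "\<And>T. T \<ge> 1 \<Longrightarrow> card (F T) \<ge> 2"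
    and var_bdd: "\<exists>C. \<forall>T\<ge>1. \<forall>l\<in>F T.
        integrable M (\<lambda>\<omega>. (periodogram (p T) (\<lambda>i. U 1 i \<omega>) (fund_freq (p T) l))\<^sup>2) \<and>
        prob_space.variance M (\<lambda>\<omega>. periodogram (p T) (\<lambda>i. U 1 i \<omega>) (fund_freq (p T) l)) \<le> C"
    and alt: "\<exists>\<delta>>0. \<forall>T\<ge>1.
        emp_var (F T) (\<lambda>l. spectral_density M (U 1) (fund_freq (p T) l)) > \<delta>"
  shows "(filterlim p at_top at_top \<longrightarrow>
      (\<forall>\<psi>::nat \<Rightarrow> real. (\<forall>T\<ge>1. 0 \<le> \<psi> T) \<and> \<psi> \<in> o(\<lambda>T. real T) \<longrightarrow>
        tendsto_infinity_in_prob M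
          (\<lambda>T \<omega>. ereal (Lambda_fin U (p T) (F T) (sigma2_hat T \<omega>) T \<omega>) / ereal (\<psi> T)))) \<and>
    (filterlim (\<lambda>T. card (F T)) at_top at_top \<and>
      (\<lambda>T. real (card (F T)) / real T) \<longlonglongrightarrow> 0 \<longrightarrow>
      (\<forall>\<psi>::nat \<Rightarrow> real. (\<forall>T\<ge>1. 0 \<le> \<psi> T) \<and> \<psi> \<in> o(\<lambda>T. real T * sqrt (real (card (F T)))) \<longrightarrow>
        tendsto_infinity_in_prob M
          (\<lambda>T \<omega>. ereal (Lambda_inf U (p T) (F T) (sigma2_hat T \<omega>) T \<omega>) / ereal (\<psi> T))))"
proof -
  interpret prob_space M by (rule prob)
  define g where "g = (\<lambda>T l. spectral_density M (U 1) (fund_freq (p T) l))"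
  define I where "I = (\<lambda>T l \<omega>. periodogram (p T) (\<lambda>i. U 1 i \<omega>) (fund_freq (p T) l))"
  define D where "D = (\<lambda>T \<omega>. 1 / (real (card (F T)) - 1) * (\<Sum>l\<in>F T. (xi U (p T) T \<omega> l - g T l)\<^sup>2))"
  obtain C where C: "\<And>T l. T \<ge> 1 \<Longrightarrow> l \<in> F T \<Longrightarrow> integrable M (\<lambda>\<omega>. (I T l \<omega>)\<^sup>2)"
    "\<And>T l. T \<ge> 1 \<Longrightarrow> l \<in> F T \<Longrightarrow> variance (I T l) \<le> C"
    using var_bdd unfolding I_def by blast
  obtain \<delta> where \<delta>: "\<delta> > 0" "\<And>T. T \<ge> 1 \<Longrightarrow> emp_var (F T) (g T) > \<delta>"
    using alt unfolding g_def by blast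
  have f: "real (card (F T)) \<ge> 2" if "T \<ge> 1" for T
    using card[OF that] by simp
  (* A degenerate process would have a vanishing, hence constant, spectral density. *)
  have "\<sigma>\<^sup>2 \<noteq> 0"
  proof
    assume "\<sigma>\<^sup>2 = 0"
    then have "autocov M (U 1) h = 0" for h
      using stationary_process_null_autocov[OF stat mean] second by simp
    then have "g 1 = (\<lambda>l. 0)" by (simp add: g_def spectral_density_def fun_eq_iff)
    then show False using \<delta>(2)[of 1] \<delta>(1) by (simp add: emp_var_def emp_mean_def)
  qed
  then have \<sigma>: "\<sigma>\<^sup>2 > 0" by simp
  \<comment> \<open>Off \<open>B T\<close> the empirical variance is at least
    \<open>\<delta> / 4\<close> and the estimator at most \<open>2 * \<sigma>\<^sup>2\<close>;
    \<open>c\<close> is the quotient of \<open>\<delta> / 4\<close> and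
    \<open>(2 * \<sigma>\<^sup>2)\<^sup>2\<close>.\<close>
  define c where "c = \<delta> / (16 * (\<sigma>\<^sup>2)\<^sup>2)"
  have c: "c > 0" using \<sigma> \<delta>(1) by (simp add: c_def)
  \<comment> \<open>Off the first set, \<open>\<delta> < 2 * v + 2 * D T\<close> for the empirical
    variance \<open>v\<close> of \<open>xi\<close> leaves \<open>v > \<delta> / 4\<close>. Off the
    second, the estimator stays positive, so division by its square is genuine.\<close>
  define B where "B = (\<lambda>T. {\<omega> \<in> space M. D T \<omega> \<ge> \<delta> / 4}
    \<union> {\<omega> \<in> space M. \<bar>sigma2_hat T \<omega> - \<sigma>\<^sup>2\<bar> > \<sigma>\<^sup>2 / 2})"
  have [measurable]: "D T \<in> borel_measurable M" for T
    unfolding D_def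
    by (intro borel_measurable_times borel_measurable_const borel_measurable_sum
        borel_measurable_power borel_measurable_diff measurable_xi[OF iid])
  have D_nonneg: "D T \<omega> \<ge> 0" if "T \<ge> 1" for T \<omega>
    unfolding D_def using f[OF that] by (intro mult_nonneg_nonneg sum_nonneg) auto
  have S_meas: "(\<lambda>\<omega>. emp_var (F T) (xi U (p T) T \<omega>)) \<in> borel_measurable M" for T
    by (intro measurable_emp_var measurable_xi[OF iid])
  have B_events: "{\<omega> \<in> space M. D T \<omega> \<ge> \<delta> / 4} \<in> events"
    "{\<omega> \<in> space M. \<bar>sigma2_hat T \<omega> - \<sigma>\<^sup>2\<bar> > \<sigma>\<^sup>2 / 2} \<in> events" "B T \<in> events" if "T \<ge> 1" for T
    using est_meas[OF that] unfolding B_def by measurable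
  have ratio: "c \<le> emp_var (F T) (xi U (p T) T \<omega>) / (sigma2_hat T \<omega>)\<^sup>2"
    if T: "T \<ge> 1" and \<omega>: "\<omega> \<in> space M - B T" for T \<omega>
  proof -
    let ?v = "emp_var (F T) (xi U (p T) T \<omega>)"
    have "D T \<omega> < \<delta> / 4" "\<bar>sigma2_hat T \<omega> - \<sigma>\<^sup>2\<bar> \<le> \<sigma>\<^sup>2 / 2"
      using \<omega> by (auto simp: B_def)
    moreover have "emp_var (F T) (g T) \<le> 2 * ?v + 2 * D T \<omega>"
      using emp_var_le_twice_emp_var_plus[OF card[OF T]] by (simp add: D_def)
    ultimately have v: "\<delta> / 4 \<le> ?v" and s: "0 < sigma2_hat T \<omega>" "sigma2_hat T \<omega> \<le> 2 * \<sigma>\<^sup>2"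
      using \<delta>(2)[OF T] \<sigma> by linarith+
    have "(sigma2_hat T \<omega>)\<^sup>2 \<le> (2 * \<sigma>\<^sup>2)\<^sup>2"
      using s by (intro power_mono) auto
    then have "c * (sigma2_hat T \<omega>)\<^sup>2 \<le> c * (2 * \<sigma>\<^sup>2)\<^sup>2"
      using c by (intro mult_left_mono) auto
    also have "\<dots> = \<delta> / 4" using \<sigma> by (simp add: c_def power_mult_distrib)
    finally show ?thesis using v s by (simp add: pos_le_divide_eq)
  qed
  \<comment> \<open>Growth of \<open>T\<close> controls the variance, growth of \<open>p\<close> the
    bias. The latter is assumed in (i) and follows from the growth of \<open>card (F T)\<close> in
    (ii).\<close>
  have B_lim: "(\<lambda>T. prob (B T)) \<longlonglongrightarrow> 0" if p: "filterlim p at_top at_top"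
  proof -
    have D_lim: "(\<lambda>T. expectation (D T)) \<longlonglongrightarrow> 0" and D_int: "\<And>T. T \<ge> 1 \<Longrightarrow> integrable M (D T)"
    proof -
      note dev = expectation_sq_xi_deviation[OF iid, folded I_def]
      show D_int: "integrable M (D T)" if "T \<ge> 1" for T
        unfolding D_def using dev(1) C(1) that
        by (intro integrable_mult_right Bochner_Integration.integrable_sum) (auto simp: I_def)
      show "(\<lambda>T. expectation (D T)) \<longlonglongrightarrow> 0"
      proof (rule tendstoI)
        fix e :: real assume e: "e > 0"
        \<comment> \<open>Variance and squared bias each get \<open>e / 8\<close>; the factor f / (f
          - 1) <= 2 turns their sum \<open>e / 4\<close> into \<open>e / 2\<close>.\<close>
        define \<epsilon> where "\<epsilon> = sqrt (e / 8)"
        have \<epsilon>: "\<epsilon> > 0" "\<epsilon>\<^sup>2 = e / 8" using e by (auto simp: \<epsilon>_def)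
        \<comment> \<open>Uniformity in the frequency matters here, since both the set
          \<open>F T\<close> and its frequencies move with \<open>T\<close>.\<close>
        have "\<forall>\<^sub>F P in at_top. \<forall>\<theta>.
          \<bar>expectation (\<lambda>\<omega>. periodogram P (\<lambda>i. U 1 i \<omega>) \<theta>) - spectral_density M (U 1) \<theta>\<bar> \<le> \<epsilon>"
          using Cesaro_cos_sums_uniform_limit[OF summ \<epsilon>(1)]
          by (simp only: expectation_periodogram[OF stat mean] spectral_density_eq_infsum_cos[OF summ])
        then have "\<forall>\<^sub>F T in sequentially. \<forall>\<theta>.
          \<bar>expectation (\<lambda>\<omega>. periodogram (p T) (\<lambda>i. U 1 i \<omega>) \<theta>) - spectral_density M (U 1) \<theta>\<bar> \<le> \<epsilon>"
          using p by (rule eventually_compose_filterlim)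
        moreover have "\<forall>\<^sub>F T in sequentially. 8 * C / e \<le> real T"
          using filterlim_real_sequentially by (simp add: filterlim_at_top)
        ultimately show "\<forall>\<^sub>F T in sequentially. dist (expectation (D T)) 0 < e"
          using eventually_ge_at_top[of 1]
        proof eventually_elim
          case (elim T)
          have CT: "C / real T \<le> e / 8" using elim(2,3) e by (simp add: field_simps)
          have fT: "real (card (F T)) - 1 > 0" using f[OF elim(3)] by simp
          have single: "expectation (\<lambda>\<omega>. (xi U (p T) T \<omega> l - g T l)\<^sup>2) \<le> e / 4" if l: "l \<in> F T" for l
          proof -
            have "\<bar>expectation (I T l) - g T l\<bar>\<^sup>2 \<le> \<epsilon>\<^sup>2"
              using elim(1) unfolding I_def g_def by (intro power_mono) auto
            moreover have "variance (I T l) / real T \<le> C / real T"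
              using C(2)[OF elim(3) l] by (intro divide_right_mono) auto
            moreover have "expectation (\<lambda>\<omega>. (xi U (p T) T \<omega> l - g T l)\<^sup>2)
                = variance (I T l) / real T + (expectation (I T l) - g T l)\<^sup>2"
              using C(1)[OF elim(3) l] elim(3) unfolding I_def
              by (rule expectation_sq_xi_deviation(2)[OF iid])
            ultimately show ?thesis using CT \<epsilon>(2) unfolding power2_abs by linarith
          qed
          have "expectation (D T) = 1 / (real (card (F T)) - 1) *
              (\<Sum>l\<in>F T. expectation (\<lambda>\<omega>. (xi U (p T) T \<omega> l - g T l)\<^sup>2))"
            unfolding D_def using C(1)[OF elim(3)] elim(3)
            by (subst integral_mult_right_zero, subst Bochner_Integration.integral_sum)
              (auto simp: I_def intro!: expectation_sq_xi_deviation(1)[OF iid])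
          also have "\<dots> \<le> 1 / (real (card (F T)) - 1) * (real (card (F T)) * (e / 4))"
            using single fT by (intro mult_left_mono sum_bounded_above) auto
          also have "\<dots> \<le> e / 2" using f[OF elim(3)] e by (simp add: field_simps)
          finally have "expectation (D T) \<le> e / 2" .
          moreover have "expectation (D T) \<ge> 0"
            using D_nonneg[OF elim(3)] by simp
          ultimately show ?case using e by simp
        qed
      qed
    qed
    have "(\<lambda>T. prob {\<omega> \<in> space M. \<bar>sigma2_hat T \<omega> - \<sigma>\<^sup>2\<bar> > \<sigma>\<^sup>2 / 2}) \<longlonglongrightarrow> 0"
      using est_cons half_gt_zero[OF \<sigma>] unfolding tendsto_in_prob_def by blast
    then have lim: "(\<lambda>T. expectation (D T) / (\<delta> / 4)
        + prob {\<omega> \<in> space M. \<bar>sigma2_hat T \<omega> - \<sigma>\<^sup>2\<bar> > \<sigma>\<^sup>2 / 2}) \<longlonglongrightarrow> 0"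
      using tendsto_add[OF tendsto_divide[OF D_lim tendsto_const[of "\<delta> / 4"]]] \<delta>(1) by fastforce
    have "\<forall>\<^sub>F T in sequentially. prob (B T) \<le> expectation (D T) / (\<delta> / 4)
        + prob {\<omega> \<in> space M. \<bar>sigma2_hat T \<omega> - \<sigma>\<^sup>2\<bar> > \<sigma>\<^sup>2 / 2}"
      using eventually_ge_at_top[of 1]
    proof eventually_elim
      case (elim T)
      have "AE \<omega> in M. 0 \<le> D T \<omega>"
        using D_nonneg[OF elim] by simp
      then have "prob {\<omega> \<in> space M. D T \<omega> \<ge> \<delta> / 4} \<le> expectation (D T) / (\<delta> / 4)"
        using \<delta>(1) D_int[OF elim] by (intro integral_Markov_inequality_measure[where A = "{}"]) auto
      then show ?case
        unfolding B_def using measure_Un_le[OF B_events(1,2)[OF elim]] by linarith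
    qed
    from tendsto_sandwich[OF _ this tendsto_const lim] show ?thesis by simp
  qed
  show ?thesis
  proof (intro conjI impI allI)
    fix \<psi> :: "nat \<Rightarrow> real"
    assume p: "filterlim p at_top at_top" and \<psi>: "(\<forall>T\<ge>1. 0 \<le> \<psi> T) \<and> \<psi> \<in> o(\<lambda>T. real T)"
    \<comment> \<open>As \<open>card (F T) \<ge> 2\<close>, the factor \<open>card (F T) - 1\<close>
      is at least 1 and may be dropped from a nonnegative product.\<close>
    have "c * real T \<le> Lambda_fin U (p T) (F T) (sigma2_hat T \<omega>) T \<omega>"
      if T: "T \<ge> 1" and \<omega>: "\<omega> \<in> space M - B T" for T \<omega>
    proof -
      let ?r = "emp_var (F T) (xi U (p T) T \<omega>) / (sigma2_hat T \<omega>)\<^sup>2"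
      have "c * real T \<le> ?r * real T" using ratio[OF T \<omega>] by (intro mult_right_mono) auto
      moreover have "0 \<le> ?r" using ratio[OF T \<omega>] c by linarith
      then have "0 \<le> ?r * real T" by (rule mult_nonneg_nonneg) simp
      then have "1 * (?r * real T) \<le> (real (card (F T)) - 1) * (?r * real T)"
        using f[OF T] by (intro mult_right_mono) auto
      ultimately have "c * real T \<le> (real (card (F T)) - 1) * (?r * real T)" by linarith
      then show ?thesis by (simp add: Lambda_fin_def mult_ac)
    qed
    then have "\<forall>\<^sub>F T in sequentially. \<forall>\<omega>\<in>space M - B T.
        c * real T \<le> Lambda_fin U (p T) (F T) (sigma2_hat T \<omega>) T \<omega>"
      by (auto simp: eventually_sequentially)
    moreover have "(\<lambda>\<omega>. Lambda_fin U (p T) (F T) (sigma2_hat T \<omega>) T \<omega>) \<in> borel_measurable M"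
      if "T \<ge> 1" for T
      unfolding Lambda_fin_def using est_meas[OF that] S_meas[of T] by measurable
    ultimately show "tendsto_infinity_in_prob M
        (\<lambda>T \<omega>. ereal (Lambda_fin U (p T) (F T) (sigma2_hat T \<omega>) T \<omega>) / ereal (\<psi> T))"
      using \<psi> c B_events(3) B_lim[OF p]
      by (intro tendsto_infinity_in_prob_divideI[where B = B and c = c and a = real]) auto
  next
    fix \<psi> :: "nat \<Rightarrow> real"
    assume "filterlim (\<lambda>T. card (F T)) at_top at_top \<and> (\<lambda>T. real (card (F T)) / real T) \<longlonglongrightarrow> 0"
      and \<psi>: "(\<forall>T\<ge>1. 0 \<le> \<psi> T) \<and> \<psi> \<in> o(\<lambda>T. real T * sqrt (real (card (F T))))"
    then have card_lim: "filterlim (\<lambda>T. card (F T)) at_top at_top" by simp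
    \<comment> \<open>The frequency indices lie in \<open>{1..p T div 2}\<close>, so a diverging
      number of them forces \<open>p\<close> to diverge.\<close>
    have "card (F T) \<le> p T" if "T \<ge> 1" for T
      using card_mono[OF _ freqs[OF that]] by simp
    then have p: "filterlim p at_top at_top"
      by (intro filterlim_at_top_mono[OF card_lim]) (auto simp: eventually_sequentially)
    \<comment> \<open>Once \<open>c * real T \<ge> 2\<close>, subtracting 1 costs at most half of
      \<open>c * real T\<close>. Another factor 1/2 comes from f / 4 <= (f - 1) / 2 under the square
      root, valid for f >= 2; hence the constant \<open>c / 4\<close>.\<close>
    have "\<forall>\<^sub>F T in sequentially. 2 / c \<le> real T"
      using filterlim_real_sequentially by (simp add: filterlim_at_top)
    then have "\<forall>\<^sub>F T in sequentially. \<forall>\<omega>\<in>space M - B T.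
        c / 4 * (real T * sqrt (real (card (F T)))) \<le> Lambda_inf U (p T) (F T) (sigma2_hat T \<omega>) T \<omega>"
      using eventually_ge_at_top[of 1]
    proof eventually_elim
      case (elim T)
      show ?case
      proof
        fix \<omega> assume \<omega>: "\<omega> \<in> space M - B T"
        let ?r = "emp_var (F T) (xi U (p T) T \<omega>) / (sigma2_hat T \<omega>)\<^sup>2"
        have "c * real T \<ge> 2" using elim(1) c by (simp add: field_simps)
        moreover have "c * real T \<le> real T * ?r"
          using mult_left_mono[OF ratio[OF elim(2) \<omega>], of "real T"] by (simp only: mult.commute[of c])
        moreover have "y - 1 \<ge> x / 2" if "x \<ge> 2" "x \<le> y" for x y :: real using that by simp
        ultimately have 1: "c * real T / 2 \<le> real T * ?r - 1" by blast
        have "sqrt (real (card (F T))) / 2 = sqrt (real (card (F T)) / 4)"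
          by (simp add: real_sqrt_divide)
        also have "\<dots> \<le> sqrt ((real (card (F T)) - 1) / 2)"
          using f[OF elim(2)] by (intro real_sqrt_le_mono) simp
        finally have 2: "sqrt (real (card (F T))) / 2 \<le> sqrt ((real (card (F T)) - 1) / 2)" .
        have "c * real T / 2 * (sqrt (real (card (F T))) / 2)
            \<le> (real T * ?r - 1) * sqrt ((real (card (F T)) - 1) / 2)"
        proof (rule mult_mono[OF 1 2])
          show "0 \<le> real T * ?r - 1" using c by (intro order_trans[OF _ 1]) simp
        qed simp
        then show "c / 4 * (real T * sqrt (real (card (F T))))
            \<le> Lambda_inf U (p T) (F T) (sigma2_hat T \<omega>) T \<omega>"
          by (simp add: Lambda_inf_def)
      qed
    qed
    moreover have "(\<lambda>\<omega>. Lambda_inf U (p T) (F T) (sigma2_hat T \<omega>) T \<omega>) \<in> borel_measurable M"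
      if "T \<ge> 1" for T
      unfolding Lambda_inf_def using est_meas[OF that] S_meas[of T] by measurable
    moreover have "real T * sqrt (real (card (F T))) > 0" if "T \<ge> 1" for T
      using f[OF that] that by simp
    ultimately show "tendsto_infinity_in_prob M
        (\<lambda>T \<omega>. ereal (Lambda_inf U (p T) (F T) (sigma2_hat T \<omega>) T \<omega>) / ereal (\<psi> T))"
      using \<psi> c B_events(3) B_lim[OF p]
      by (intro tendsto_infinity_in_prob_divideI[where B = B and c = "c / 4"
            and a = "\<lambda>T. real T * sqrt (real (card (F T)))"]) auto
  qed
qed

end
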